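(* Let $f\in\mathcal{C}(\Omega)$ and $\lambda>0$, and let the quadrature rule have exactness degree $2n$. Then the hard thresholding hyperinterpolation $\mathcal{H}_n^{\lambda}f\in\mathbb{P}_n(\Omega)$ of $f$ is the unique solution to the $\ell_0$-regularized weighted least squares approximation problem $$\min_{p_\lambda\in\mathbb{P}_n(\Omega)}\left\{\sum_{j=1}^{N} w_j\,[p_{\lambda}(\mathbf{x}_j)-f(\mathbf{x}_j)]^2+\lambda^2\sum_{\ell=1}^{d_n}|\beta_{\ell}^{\lambda}|_0\right\},\qquad p_{\lambda}(\mathbf{x})=\sum_{\ell=1}^{d_n}\beta_{\ell}^{\lambda}\Phi_{\ell}(\mathbf{x}).$$
   Context: $\Omega\subset\mathbb{R}^s$ is a compact smooth Riemannian manifold with smooth or empty boundary, equipped with a measure $\mathrm{d}\omega$ with $\int_\Omega \mathrm{d}\omega=V<\infty$. $\mathcal{C}(\Omega)$ is the space of continuous real functions on $\Omega$, and $\langle f,g\rangle=\int_\Omega fg\,\mathrm{d}\omega$. $\mathbb{P}_n(\Omega)$ is the space of polynomials of total degree at most $n$ restricted to $\Omega$, $d_n=\dim\mathbb{P}_n(\Omega)$, and $\{\Phi_\ell\}_{\ell=1}^{d_n}$ is a fixed orthonormal basis of $\mathbb{P}_n(\Omega)$ with respect to $\langle\cdot,\cdot\rangle$. Quadrature rule: nodes $\mathbf{x}_1,\dots,\mathbf{x}_N\in\Omega$ and weights $w_1,\dots,w_N>0$ such that $\int_\Omega p\,\mathrm{d}\omega=\sum_{j=1}^N w_jp(\mathbf{x}_j)$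 for all $p\in\mathbb{P}_{2n}(\Omega)$ (exactness degree $2n$). The discrete (semi) inner product is $\langle f,g\rangle_N=\sum_{j=1}^N w_jf(\mathbf{x}_j)g(\mathbf{x}_j)$. For $\beta\in\mathbb{R}$, $|\beta|_0=0$ if $\beta=0$ and $|\beta|_0=1$ if $\beta\neq0$. The hard thresholding operator is $\eta_H(a,k)=a$ if $|a|>k$ and $\eta_H(a,k)=0$ if $|a|\le k$. The hard thresholding hyperinterpolation of $f$ is $\mathcal{H}_n^\lambda f=\sum_{\ell=1}^{d_n}\eta_H(\langle f,\Phi_\ell\rangle_N,\lambda)\Phi_\ell$, $\lambda>0$.
   Formalization: Uniqueness fails when |⟨f,Φ_ℓ⟩_N| = λ for some ℓ (e.g. f = λΦ_1, where 0 and λΦ_1 both minimize); proved instead: H_n^λ f always lies in P_n(Ω) and is a minimizer, and it is the unique one iff no ℓ has |⟨f,Φ_ℓ⟩_N| = λ. *)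

theory Defs
  imports "HOL-Analysis.Analysis" "HOL-Library.Function_Algebras"
begin

primrec continuously_differentiable_on ::
  "nat \<Rightarrow> ('a::euclidean_space \<Rightarrow> 'b::euclidean_space) \<Rightarrow> 'a set \<Rightarrow> bool" where
  "continuously_differentiable_on 0 f S \<longleftrightarrow> continuous_on S f"
| "continuously_differentiable_on (Suc k) f S \<longleftrightarrow>
     (\<forall>x\<in>S. f differentiable (at x)) \<and>
     (\<forall>v. continuously_differentiable_on k (\<lambda>x. frechet_derivative f (at x) v) S)"

definition smooth_on :: "('a::euclidean_space \<Rightarrow> 'b::euclidean_space) \<Rightarrow> 'a set \<Rightarrow> bool" where
  "smooth_on f S \<longleftrightarrow> (\<forall>k. continuously_differentiable_on k f S)"

definition smooth_diffeomorphism ::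
  "'a::euclidean_space set \<Rightarrow> 'a set \<Rightarrow> ('a \<Rightarrow> 'a) \<Rightarrow> ('a \<Rightarrow> 'a) \<Rightarrow> bool" where
  "smooth_diffeomorphism U W \<phi> \<psi> \<longleftrightarrow>
     open U \<and> open W \<and> homeomorphism U W \<phi> \<psi> \<and> smooth_on \<phi> U \<and> smooth_on \<psi> W"

text \<open>Local slice condition for embedded submanifolds of dimension \<open>m\<close>: in an ambient chart
  around each point, the set is an open piece of an \<open>m\<close>-dimensional linear subspace \<open>L\<close>, or of a
  closed half-space of \<open>L\<close>. The boundary may be empty. The Riemannian metric is the one
  induced by the ambient inner product, so it is determined by the set.\<close>

definition smooth_submanifold_with_boundary :: "nat \<Rightarrow> 'a::euclidean_space set \<Rightarrow> bool" where
  "smooth_submanifold_with_boundary m \<Omega> \<longleftrightarrow>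
     (\<forall>x\<in>\<Omega>. \<exists>U W \<phi> \<psi> L. x \<in> U \<and> smooth_diffeomorphism U W \<phi> \<psi> \<and> subspace L \<and> dim L = m \<and>
        (\<phi> ` (U \<inter> \<Omega>) = W \<inter> L \<or>
         (\<exists>e\<in>L. e \<noteq> 0 \<and> \<phi> ` (U \<inter> \<Omega>) = W \<inter> {y \<in> L. 0 \<le> e \<bullet> y})))"

definition fun_scale :: "real \<Rightarrow> ('b \<Rightarrow> real) \<Rightarrow> 'b \<Rightarrow> real" where
  "fun_scale c f = (\<lambda>x. c * f x)"

global_interpretation funspace: vector_space "fun_scale :: real \<Rightarrow> ('b \<Rightarrow> real) \<Rightarrow> 'b \<Rightarrow> real"
  by unfold_locales (auto simp: fun_scale_def fun_eq_iff algebra_simps)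

definition monomial_fun :: "('s::finite \<Rightarrow> nat) \<Rightarrow> real ^ 's \<Rightarrow> real" where
  "monomial_fun \<alpha> x = (\<Prod>i\<in>UNIV. (x $ i) ^ \<alpha> i)"

definition polynomials :: "nat \<Rightarrow> (real ^ 's::finite \<Rightarrow> real) set" where
  "polynomials n = funspace.span {monomial_fun \<alpha> | \<alpha>. (\<Sum>i\<in>UNIV. \<alpha> i) \<le> n}"

text \<open>The restriction of a function to \<open>\<Omega>\<close> is represented by its extension by zero, so that
  restrictions form a subspace and are equal iff the functions agree on \<open>\<Omega>\<close>.\<close>

definition restrict_zero :: "'b set \<Rightarrow> ('b \<Rightarrow> real) \<Rightarrow> 'b \<Rightarrow> real" where
  "restrict_zero \<Omega> p = (\<lambda>x. if x \<in> \<Omega> then p x else 0)"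

definition poly_space :: "nat \<Rightarrow> (real ^ 's::finite) set \<Rightarrow> (real ^ 's \<Rightarrow> real) set" where
  "poly_space n \<Omega> = restrict_zero \<Omega> ` polynomials n"

definition poly_dim :: "nat \<Rightarrow> (real ^ 's::finite) set \<Rightarrow> nat" where
  "poly_dim n \<Omega> = funspace.dim (poly_space n \<Omega>)"

definition L2_product :: "'b measure \<Rightarrow> ('b \<Rightarrow> real) \<Rightarrow> ('b \<Rightarrow> real) \<Rightarrow> real" where
  "L2_product \<omega> f g = (\<integral>x. f x * g x \<partial>\<omega>)"

definition orthonormal_poly_basis ::
  "nat \<Rightarrow> (real ^ 's::finite) set \<Rightarrow> (real ^ 's) measure \<Rightarrow> (nat \<Rightarrow> real ^ 's \<Rightarrow> real) \<Rightarrow> bool" where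
  "orthonormal_poly_basis n \<Omega> \<omega> \<Phi> \<longleftrightarrow>
     funspace.span (\<Phi> ` {1..poly_dim n \<Omega>}) = poly_space n \<Omega> \<and>
     (\<forall>k\<in>{1..poly_dim n \<Omega>}. \<forall>l\<in>{1..poly_dim n \<Omega>}.
        L2_product \<omega> (\<Phi> k) (\<Phi> l) = (if k = l then 1 else 0))"

definition quadrature_rule ::
  "nat \<Rightarrow> (real ^ 's::finite) set \<Rightarrow> (real ^ 's) measure \<Rightarrow> nat \<Rightarrow> (nat \<Rightarrow> real ^ 's) \<Rightarrow> (nat \<Rightarrow> real) \<Rightarrow> bool" where
  "quadrature_rule t \<Omega> \<omega> N x w \<longleftrightarrow>
     (\<forall>j\<in>{1..N}. x j \<in> \<Omega> \<and> w j > 0) \<and>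
     (\<forall>p\<in>poly_space t \<Omega>. (\<integral>y. p y \<partial>\<omega>) = (\<Sum>j=1..N. w j * p (x j)))"

definition discrete_product ::
  "nat \<Rightarrow> (nat \<Rightarrow> 'b) \<Rightarrow> (nat \<Rightarrow> real) \<Rightarrow> ('b \<Rightarrow> real) \<Rightarrow> ('b \<Rightarrow> real) \<Rightarrow> real" where
  "discrete_product N x w f g = (\<Sum>j=1..N. w j * f (x j) * g (x j))"

definition abs0 :: "real \<Rightarrow> real" where
  "abs0 \<beta> = (if \<beta> = 0 then 0 else 1)"

definition hard_threshold :: "real \<Rightarrow> real \<Rightarrow> real" where
  "hard_threshold a k = (if \<bar>a\<bar> > k then a else 0)"

definition hard_hyperinterpolation ::
  "nat \<Rightarrow> (real ^ 's::finite) set \<Rightarrow> (nat \<Rightarrow> real ^ 's \<Rightarrow> real) \<Rightarrow> nat \<Rightarrow> (nat \<Rightarrow> real ^ 's) \<Rightarrow> (nat \<Rightarrow> real)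
     \<Rightarrow> real \<Rightarrow> (real ^ 's \<Rightarrow> real) \<Rightarrow> real ^ 's \<Rightarrow> real" where
  "hard_hyperinterpolation n \<Omega> \<Phi> N x w lam f =
     (\<lambda>y. \<Sum>l=1..poly_dim n \<Omega>. hard_threshold (discrete_product N x w f (\<Phi> l)) lam * \<Phi> l y)"

definition basis_coeff ::
  "nat \<Rightarrow> (real ^ 's::finite) set \<Rightarrow> (nat \<Rightarrow> real ^ 's \<Rightarrow> real) \<Rightarrow> (real ^ 's \<Rightarrow> real) \<Rightarrow> nat \<Rightarrow> real" where
  "basis_coeff n \<Omega> \<Phi> p l = funspace.representation (\<Phi> ` {1..poly_dim n \<Omega>}) p (\<Phi> l)"

definition l0_objective ::
  "nat \<Rightarrow> (real ^ 's::finite) set \<Rightarrow> (nat \<Rightarrow> real ^ 's \<Rightarrow> real) \<Rightarrow> nat \<Rightarrow> (nat \<Rightarrow> real ^ 's) \<Rightarrow> (nat \<Rightarrow> real)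
     \<Rightarrow> real \<Rightarrow> (real ^ 's \<Rightarrow> real) \<Rightarrow> (real ^ 's \<Rightarrow> real) \<Rightarrow> real" where
  "l0_objective n \<Omega> \<Phi> N x w lam f p =
     (\<Sum>j=1..N. w j * (p (x j) - f (x j))\<^sup>2) +
     lam\<^sup>2 * (\<Sum>l=1..poly_dim n \<Omega>. abs0 (basis_coeff n \<Omega> \<Phi> p l))"

end

theory Submission
  imports Defs
begin

text \<open>Exactness in degree \<open>2n\<close> makes the basis \<open>\<Phi>\<close> orthonormal for the discrete product as well.
  Hence, with \<open>a\<^sub>l = \<langle>f, \<Phi>\<^sub>l\<rangle>\<^sub>N\<close>, the objective at \<open>p = (\<Sum>l. \<beta>\<^sub>l \<Phi>\<^sub>l)\<close> equals
  \<open>\<langle>f, f\<rangle>\<^sub>N + (\<Sum>l. \<beta>\<^sub>l\<^sup>2 - 2 a\<^sub>l \<beta>\<^sub>l + \<lambda>\<^sup>2 |\<beta>\<^sub>l|\<^sub>0)\<close> and decouples into scalar problems. Each of them is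
  solved by \<open>\<beta>\<^sub>l = \<eta>\<^sub>H(a\<^sub>l, \<lambda>)\<close>, and by no other value unless \<open>|a\<^sub>l| = \<lambda>\<close>, where \<open>0\<close> and \<open>a\<^sub>l\<close> tie.\<close>

lemma monomial_fun_mult:
  "monomial_fun \<alpha> * monomial_fun \<beta> = monomial_fun (\<lambda>i. \<alpha> i + \<beta> i)"
  by (simp add: monomial_fun_def fun_eq_iff power_add prod.distrib)

text \<open>Multiplication is bilinear, so an induction over the span in each factor reduces the
  claim to two monomials, whose exponents add.\<close>

lemma polynomials_mult:
  assumes p: "p \<in> polynomials m" and q: "q \<in> polynomials n"
  shows "p * q \<in> polynomials (m + n)"
proof -
  have sub: "funspace.subspace (polynomials k :: (real ^ 's \<Rightarrow> real) set)" for k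
    unfolding polynomials_def by (rule funspace.subspace_span)
  have mono: "monomial_fun \<alpha> * q \<in> polynomials (m + n)" if \<alpha>: "(\<Sum>i\<in>UNIV. \<alpha> i) \<le> m" for \<alpha>
    using q unfolding polynomials_def[of n]
  proof (induction rule: funspace.span_induct_alt)
    case base
    then show ?case using funspace.subspace_0[OF sub, of "m + n"] by (simp add: zero_fun_def times_fun_def)
  next
    case (step c r s)
    then obtain \<beta> where r: "r = monomial_fun \<beta>" and \<beta>: "(\<Sum>i\<in>UNIV. \<beta> i) \<le> n" by auto
    have "(\<Sum>i\<in>UNIV. \<alpha> i + \<beta> i) \<le> m + n"
      unfolding sum.distrib using \<alpha> \<beta> by (rule add_mono)
    then have "monomial_fun \<alpha> * r \<in> polynomials (m + n)"
      unfolding r monomial_fun_mult polynomials_def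
      by (intro funspace.span_base CollectI exI[of _ "\<lambda>i. \<alpha> i + \<beta> i"] conjI refl)
    then have "fun_scale c (monomial_fun \<alpha> * r) + monomial_fun \<alpha> * s \<in> polynomials (m + n)"
      using step.IH sub by (intro funspace.subspace_add funspace.subspace_scale)
    also have "fun_scale c (monomial_fun \<alpha> * r) + monomial_fun \<alpha> * s
        = monomial_fun \<alpha> * (fun_scale c r + s)"
      by (simp add: fun_eq_iff fun_scale_def algebra_simps)
    finally show ?case .
  qed
  show ?thesis using p unfolding polynomials_def[of m]
  proof (induction rule: funspace.span_induct_alt)
    case base
    then show ?case using funspace.subspace_0[OF sub, of "m + n"] by (simp add: zero_fun_def times_fun_def)
  next
    case (step c r s)
    then have "r * q \<in> polynomials (m + n)" using mono by auto
    then have "fun_scale c (r * q) + s * q \<in> polynomials (m + n)"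
      using step.IH sub by (intro funspace.subspace_add funspace.subspace_scale)
    also have "fun_scale c (r * q) + s * q = (fun_scale c r + s) * q"
      by (simp add: fun_eq_iff fun_scale_def algebra_simps)
    finally show ?case .
  qed
qed

lemma poly_space_mult:
  assumes "p \<in> poly_space m \<Omega>" and "q \<in> poly_space n \<Omega>"
  shows "p * q \<in> poly_space (m + n) \<Omega>"
proof -
  obtain p' q' where p': "p' \<in> polynomials m" "p = restrict_zero \<Omega> p'"
    and q': "q' \<in> polynomials n" "q = restrict_zero \<Omega> q'"
    using assms unfolding poly_space_def by auto
  have "p * q = restrict_zero \<Omega> (p' * q')"
    by (simp add: p' q' restrict_zero_def fun_eq_iff)
  then show ?thesis
    unfolding poly_space_def using polynomials_mult[OF p'(1) q'(1)] by blast
qed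

text \<open>A product of two basis elements has degree at most \<open>2 * n\<close>, so the
  quadrature rule integrates it exactly and the Gram matrix for \<open>\<omega>\<close> is also the
  one for the nodes.\<close>

lemma discrete_product_orthonormal:
  assumes basis: "orthonormal_poly_basis n \<Omega> \<omega> \<Phi>"
    and quad: "quadrature_rule (2 * n) \<Omega> \<omega> N x w"
    and k: "k \<in> {1..poly_dim n \<Omega>}" and l: "l \<in> {1..poly_dim n \<Omega>}"
  shows "discrete_product N x w (\<Phi> k) (\<Phi> l) = (if k = l then 1 else 0)"
proof -
  have "\<Phi> i \<in> poly_space n \<Omega>" if "i \<in> {1..poly_dim n \<Omega>}" for i
    using that basis funspace.span_base[of "\<Phi> i" "\<Phi> ` {1..poly_dim n \<Omega>}"]
    unfolding orthonormal_poly_basis_def by blast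
  from poly_space_mult[OF this this, OF k l]
  have "\<Phi> k * \<Phi> l \<in> poly_space (2 * n) \<Omega>" by (simp add: mult_2)
  then have "(\<integral>y. (\<Phi> k * \<Phi> l) y \<partial>\<omega>) = (\<Sum>j=1..N. w j * (\<Phi> k * \<Phi> l) (x j))"
    using quad unfolding quadrature_rule_def by blast
  moreover have "(\<integral>y. \<Phi> k y * \<Phi> l y \<partial>\<omega>) = (if k = l then 1 else 0)"
    using basis k l unfolding orthonormal_poly_basis_def L2_product_def by blast
  ultimately show ?thesis by (simp add: discrete_product_def mult.assoc)
qed

lemma discrete_product_commute: "discrete_product N x w f g = discrete_product N x w g f"
  by (simp add: discrete_product_def mult_ac)

lemma discrete_product_sum_left:
  "discrete_product N x w (\<lambda>y. \<Sum>l\<in>A. c l * F l y) g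
     = (\<Sum>l\<in>A. c l * discrete_product N x w (F l) g)"
  unfolding discrete_product_def sum_distrib_left sum_distrib_right
  by (subst sum.swap) (simp add: mult_ac)

lemma discrete_product_residual:
  "(\<Sum>j=1..N. w j * (p (x j) - f (x j))\<^sup>2)
     = discrete_product N x w p p - 2 * discrete_product N x w p f + discrete_product N x w f f"
  by (simp add: discrete_product_def sum_distrib_left power2_eq_square algebra_simps
      flip: sum.distrib sum_subtractf)

text \<open>Pairing with \<open>F l\<close> kills every other term. This serves twice: for linear
  independence, and for identifying the coefficients of a given polynomial.\<close>

lemma discrete_product_combination_orthonormal:
  assumes "finite A" and "l \<in> A"
    and "\<And>k. k \<in> A \<Longrightarrow> discrete_product N x w (F k) (F l) = (if k = l then 1 else 0)"
  shows "discrete_product N x w (\<lambda>y. \<Sum>k\<in>A. c k * F k y) (F l) = c l"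
proof -
  have "(\<Sum>k\<in>A. c k * discrete_product N x w (F k) (F l)) = (\<Sum>k\<in>A. if k = l then c k else 0)"
    using assms(3) by (intro sum.cong) auto
  then show ?thesis using assms(1,2) by (simp add: discrete_product_sum_left)
qed

lemma sum_fun_scale: "(\<Sum>l\<in>A. fun_scale (c l) (F l)) = (\<lambda>y. \<Sum>l\<in>A. c l * F l y)"
  by (induction A rule: infinite_finite_induct) (auto simp: fun_scale_def fun_eq_iff)

text \<open>Pairing a vanishing combination with \<open>F l\<close> extracts its coefficient at
  \<open>l\<close>, which must be 0. Injectivity is a separate claim because independence of the
  image set cannot detect repeated indices.\<close>

lemma independent_of_discrete_orthonormal:
  assumes A: "finite A"
    and orth: "\<And>k l. k \<in> A \<Longrightarrow> l \<in> A \<Longrightarrow>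
      discrete_product N x w (F k) (F l) = (if k = l then 1 else 0)"
  shows "inj_on F A" and "funspace.independent (F ` A)"
proof -
  show inj: "inj_on F A"
    \<comment> \<open>If \<open>F k = F l\<close> for distinct indices, one and the same product
      would be both 0 and 1.\<close>
    by (rule inj_onI) (metis orth zero_neq_one)
  show "funspace.independent (F ` A)"
  proof
    assume "funspace.dependent (F ` A)"
    then obtain u l where l: "l \<in> A" "u (F l) \<noteq> 0"
      and "(\<Sum>v\<in>F ` A. fun_scale (u v) v) = 0"
      using A by (auto simp: funspace.dependent_finite)
    then have "(\<lambda>y. \<Sum>k\<in>A. u (F k) * F k y) = 0"
      using inj by (simp add: sum.reindex sum_fun_scale)
    moreover have "discrete_product N x w 0 (F l) = 0"
      by (simp add: discrete_product_def)
    ultimately have "u (F l) = 0"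
      using discrete_product_combination_orthonormal[where c="\<lambda>k. u (F k)", OF A l(1) orth]
      using l(1) by simp
    with l show False by simp
  qed
qed

text \<open>For nonzero \<open>c\<close>, completing the square gives
  \<open>g c = (c - a)\<^sup>2 + (lam\<^sup>2 - a\<^sup>2)\<close>, while \<open>g 0 = 0\<close>. So
  only 0 and \<open>a\<close> compete, and the sign of \<open>lam\<^sup>2 - a\<^sup>2\<close>
  decides.\<close>

lemma scalar_objective_hard_threshold:
  fixes a \<beta> lam :: real
  assumes "lam > 0"
  defines "g \<equiv> \<lambda>c. c\<^sup>2 - 2 * c * a + lam\<^sup>2 * abs0 c"
  shows "g (hard_threshold a lam) \<le> g \<beta>"
    and "\<bar>a\<bar> \<noteq> lam \<Longrightarrow> \<beta> \<noteq> hard_threshold a lam \<Longrightarrow> g (hard_threshold a lam) < g \<beta>"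
    and "\<bar>a\<bar> = lam \<Longrightarrow> g a = g (hard_threshold a lam)"
proof -
  have g: "g c = (if c = 0 then 0 else (c - a)\<^sup>2 + (lam\<^sup>2 - a\<^sup>2))" for c
    by (simp add: g_def abs0_def power2_eq_square algebra_simps)
  have gt: "\<bar>a\<bar> > lam \<Longrightarrow> lam\<^sup>2 < a\<^sup>2" and lt: "\<bar>a\<bar> < lam \<Longrightarrow> a\<^sup>2 < lam\<^sup>2"
    using power_strict_mono[of lam "\<bar>a\<bar>" 2] power_strict_mono[of "\<bar>a\<bar>" lam 2] assms(1) by simp_all
  have eq: "\<bar>a\<bar> = lam \<Longrightarrow> a\<^sup>2 = lam\<^sup>2" by auto
  have sq: "0 \<le> (\<beta> - a)\<^sup>2" and sq': "\<beta> \<noteq> a \<Longrightarrow> 0 < (\<beta> - a)\<^sup>2" by simp_all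
  show "g (hard_threshold a lam) \<le> g \<beta>"
    using gt lt eq sq assms(1) unfolding g hard_threshold_def by (cases "\<bar>a\<bar>" lam rule: linorder_cases) auto
  show "g (hard_threshold a lam) < g \<beta>" if "\<bar>a\<bar> \<noteq> lam" "\<beta> \<noteq> hard_threshold a lam"
    using that gt lt sq sq' assms(1) unfolding g hard_threshold_def
    by (cases "\<bar>a\<bar>" lam rule: linorder_cases) (auto intro: add_nonneg_pos)
  show "g a = g (hard_threshold a lam)" if "\<bar>a\<bar> = lam"
    using that eq by (simp add: g hard_threshold_def)
qed

text \<open>Uniqueness takes the form of an equivalence because it fails as soon as one discrete
  coefficient has modulus exactly \<open>lam\<close>; the hard thresholding hyperinterpolation is
  then still a minimizer, but not the only one.\<close>

theorem theorem2p1: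
  fixes \<Omega> :: "(real ^ 's::finite) set" and \<omega> :: "(real ^ 's) measure"
    and \<Phi> :: "nat \<Rightarrow> real ^ 's \<Rightarrow> real" and f :: "real ^ 's \<Rightarrow> real"
    and x :: "nat \<Rightarrow> real ^ 's" and w :: "nat \<Rightarrow> real"
    and m n N :: nat and lam :: real
  assumes "compact \<Omega>" and "smooth_submanifold_with_boundary m \<Omega>"
    and "sets \<omega> = sets (restrict_space borel \<Omega>)" and "finite_measure \<omega>"
    and "orthonormal_poly_basis n \<Omega> \<omega> \<Phi>"
    and "quadrature_rule (2 * n) \<Omega> \<omega> N x w"
    and "continuous_on \<Omega> f" and "lam > 0"
  shows "hard_hyperinterpolation n \<Omega> \<Phi> N x w lam f \<in> poly_space n \<Omega> \<and>
    is_arg_min (l0_objective n \<Omega> \<Phi> N x w lam f) (\<lambda>p. p \<in> poly_space n \<Omega>)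
      (hard_hyperinterpolation n \<Omega> \<Phi> N x w lam f) \<and>
    ((\<forall>p. is_arg_min (l0_objective n \<Omega> \<Phi> N x w lam f) (\<lambda>p. p \<in> poly_space n \<Omega>) p
          \<longrightarrow> p = hard_hyperinterpolation n \<Omega> \<Phi> N x w lam f)
      \<longleftrightarrow> (\<forall>l\<in>{1..poly_dim n \<Omega>}. \<bar>discrete_product N x w f (\<Phi> l)\<bar> \<noteq> lam))"
proof -
  define D where "D = {1..poly_dim n \<Omega>}"
  define comb where "comb = (\<lambda>c y. \<Sum>l\<in>D. c l * \<Phi> l y)"
  define a where "a = (\<lambda>l. discrete_product N x w f (\<Phi> l))"
  define h where "h = (\<lambda>l. hard_threshold (a l) lam)"
  define g where "g = (\<lambda>l c. c\<^sup>2 - 2 * c * a l + lam\<^sup>2 * abs0 c)"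
  define J where "J = l0_objective n \<Omega> \<Phi> N x w lam f"
  have D: "finite D" by (simp add: D_def)
  have orth: "discrete_product N x w (\<Phi> k) (\<Phi> l) = (if k = l then 1 else 0)"
    if "k \<in> D" "l \<in> D" for k l
    using that discrete_product_orthonormal[OF assms(5,6)] unfolding D_def by blast
  have inj: "inj_on \<Phi> D" and indep: "funspace.independent (\<Phi> ` D)"
    using independent_of_discrete_orthonormal[OF D orth] by blast+
  have span: "funspace.span (\<Phi> ` D) = poly_space n \<Omega>"
    using assms(5) unfolding orthonormal_poly_basis_def D_def by blast
  have comb_in: "comb c \<in> poly_space n \<Omega>" for c
    unfolding comb_def span[symmetric] sum_fun_scale[symmetric]
    by (intro funspace.span_sum funspace.span_scale funspace.span_base imageI)
  have comb_product: "discrete_product N x w (comb c) (\<Phi> l) = c l" if "l \<in> D" for c l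
    unfolding comb_def using that orth
    by (intro discrete_product_combination_orthonormal D) auto
  have expand: "comb (basis_coeff n \<Omega> \<Phi> p) = p" if "p \<in> poly_space n \<Omega>" for p
  proof -
    have "(\<Sum>v\<in>\<Phi> ` D. fun_scale (funspace.representation (\<Phi> ` D) p v) v) = p"
      using that D indep span by (intro funspace.sum_representation_eq) auto
    \<comment> \<open>\<open>representation\<close> is indexed by basis vectors; injectivity of
      \<open>\<Phi>\<close> turns the sum over vectors into a sum over indices.\<close>
    then show ?thesis
      using inj unfolding comb_def basis_coeff_def D_def[symmetric]
      by (simp add: sum.reindex sum_fun_scale)
  qed
  \<comment> \<open>By \<open>expand\<close>, both coefficient families give the same function, and
    pairing it with \<open>\<Phi> l\<close> returns either of them.\<close>
  have coeff: "basis_coeff n \<Omega> \<Phi> (comb c) l = c l" if "l \<in> D" for c l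
    using comb_product[OF that] expand[OF comb_in] by metis
  have J_comb: "J (comb c) = discrete_product N x w f f + (\<Sum>l\<in>D. g l (c l))" for c
  proof -
    have "discrete_product N x w (comb c) (comb c) = (\<Sum>l\<in>D. c l * c l)"
      \<comment> \<open>Only one factor is expanded; \<open>comb_product\<close> evaluates the
        pairing of each \<open>\<Phi> l\<close> with the other, so no double sum arises.\<close>
      by (subst (1) comb_def, subst discrete_product_sum_left, subst discrete_product_commute)
        (simp add: comb_product)
    moreover have "discrete_product N x w (comb c) f = (\<Sum>l\<in>D. c l * a l)"
      unfolding comb_def discrete_product_sum_left a_def
      by (simp add: discrete_product_commute[of _ _ _ f])
    ultimately show ?thesis
      unfolding J_def l0_objective_def discrete_product_residual D_def[symmetric]
      by (simp add: coeff g_def sum.distrib sum_subtractf sum_distrib_left power2_eq_square mult.assoc)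
  qed
  have H: "hard_hyperinterpolation n \<Omega> \<Phi> N x w lam f = comb h"
    unfolding hard_hyperinterpolation_def comb_def h_def a_def D_def ..
  note scalar = scalar_objective_hard_threshold[OF \<open>lam > 0\<close>]
  have g_le: "g l (h l) \<le> g l c" for l c
    unfolding g_def h_def by (rule scalar(1))
  have J_le: "J (comb h) \<le> J p" if "p \<in> poly_space n \<Omega>" for p
  proof -
    have "J (comb h) \<le> J (comb (basis_coeff n \<Omega> \<Phi> p))"
      unfolding J_comb by (intro add_left_mono sum_mono g_le)
    then show ?thesis using expand[OF that] by simp
  qed
  \<comment> \<open>Since \<open>comb h\<close> attains the minimum, the minimizers are exactly the
    admissible functions with the same objective value.\<close>
  have min_iff: "is_arg_min J (\<lambda>p. p \<in> poly_space n \<Omega>) p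
      \<longleftrightarrow> p \<in> poly_space n \<Omega> \<and> J p = J (comb h)" for p
    using J_le J_le[of p] comb_in[of h] by (force simp: is_arg_min_linorder)
  have unique: "p = comb h"
    if no_tie: "\<forall>l\<in>D. \<bar>a l\<bar> \<noteq> lam" and p: "p \<in> poly_space n \<Omega>" and J_eq: "J p = J (comb h)" for p
  proof -
    define c where "c = basis_coeff n \<Omega> \<Phi> p"
    have c: "comb c = p" unfolding c_def by (rule expand[OF p])
    have "c l = h l" if l: "l \<in> D" for l
    proof (rule ccontr)
      assume "c l \<noteq> h l"
      then have "g l (h l) < g l (c l)"
        using no_tie l scalar(2)[of "a l" "c l"] unfolding g_def h_def by blast
      \<comment> \<open>A single differing coefficient suffices: its term is strictly larger, and
        \<open>g_le\<close> bounds all the others.\<close>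
      then have "(\<Sum>l\<in>D. g l (h l)) < (\<Sum>l\<in>D. g l (c l))"
        using D l g_le by (intro sum_strict_mono_ex1) auto
      then show False using J_eq unfolding c[symmetric] J_comb by simp
    qed
    then have "comb c = comb h" unfolding comb_def by simp
    with c show ?thesis by simp
  qed
  have tie: "\<exists>p. p \<in> poly_space n \<Omega> \<and> J p = J (comb h) \<and> p \<noteq> comb h"
    if l: "l \<in> D" and eq: "\<bar>a l\<bar> = lam" for l
  proof (intro exI conjI)
    \<comment> \<open>The strict threshold gives \<open>h l = 0\<close> at a tie. Replacing this by
      \<open>a l\<close>, which is nonzero because its modulus is \<open>lam > 0\<close>, changes
      the function but not the objective.\<close>
    let ?c = "h(l := a l)"
    show "comb ?c \<in> poly_space n \<Omega>" by (rule comb_in)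
    have "g l (a l) = g l (h l)"
      unfolding g_def h_def by (rule scalar(3)[OF eq])
    then have "g k (?c k) = g k (h k)" for k by simp
    then show "J (comb ?c) = J (comb h)" unfolding J_comb by simp
    have "?c l \<noteq> h l" using eq \<open>lam > 0\<close> by (auto simp: h_def hard_threshold_def)
    then show "comb ?c \<noteq> comb h" using coeff[OF l] by metis
  qed
  have "(\<forall>p. is_arg_min J (\<lambda>p. p \<in> poly_space n \<Omega>) p \<longrightarrow> p = comb h) \<longleftrightarrow> (\<forall>l\<in>D. \<bar>a l\<bar> \<noteq> lam)"
    unfolding min_iff using unique tie by blast
  moreover have "is_arg_min J (\<lambda>p. p \<in> poly_space n \<Omega>) (comb h)"
    unfolding min_iff using comb_in by blast
  ultimately show ?thesis
    unfolding H J_def a_def D_def[symmetric] using comb_in by blast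
qed

end
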